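(* The map $\tilde H:(x,y)\mapsto(\bar x,\bar y)$ defined by $$\tilde H:\quad \bar x = y+\varepsilon(x,\bar y)-\varepsilon(\bar y,x),\qquad \bar y=-x+F\bigl(y-\varepsilon(\bar y,x)\bigr)$$ is reversible with respect to the involution $h:(x,y)\mapsto(y,x)$.
   Context: A $C^r$-map (diffeomorphism) $f$ is called reversible with respect to an involution $\mathcal G$ (a diffeomorphism, also at least $C^r$-smooth, with $\mathcal G^2=\mathrm{Id}$) if $f=\mathcal G\circ f^{-1}\circ\mathcal G$. Here $F(y)$ is some nonlinear function of one variable (e.g. a polynomial), and $\varepsilon(x,y)$ is a sufficiently smooth (analytic) function of two variables, the perturbation. The planar map $\tilde H$, which is understood to be a diffeomorphism as in the definition of reversibility, is given implicitly by the two displayed relations, where $(\bar x,\bar y)$ denotes the image of $(x,y)$. It is a perturbation of the area-preserving Hénon-like map $H:\ \bar x=y,\ \bar y=-x+F(y)$, which is obtained for $\varepsilon\equiv 0$ and is itself reversible with respect to $h$. *)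

theory Defs
  imports "HOL-Analysis.Analysis"
begin

text \<open>
  Being \<open>C\<^sup>r\<close> on a whole Euclidean space. In the recursive step all directional derivatives
  \<open>x \<mapsto> Df(x) v\<close> are required to be one class less smooth; in finite dimension this is the same as
  asking it of \<open>x \<mapsto> Df(x)\<close>, and it keeps the type of the map unchanged along the recursion.
\<close>
primrec Cr_map :: "nat \<Rightarrow> ('a::euclidean_space \<Rightarrow> 'b::euclidean_space) \<Rightarrow> bool" where
  "Cr_map 0 f \<longleftrightarrow> continuous_on UNIV f"
| "Cr_map (Suc r) f \<longleftrightarrow>
     (\<forall>x. f differentiable (at x)) \<and> (\<forall>v. Cr_map r (\<lambda>x. frechet_derivative f (at x) v))"

definition Cr_diffeomorphism :: "nat \<Rightarrow> ('a::euclidean_space \<Rightarrow> 'a) \<Rightarrow> bool" where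
  "Cr_diffeomorphism r f \<longleftrightarrow> bij f \<and> Cr_map r f \<and> Cr_map r (inv f)"

definition Cr_involution :: "nat \<Rightarrow> ('a::euclidean_space \<Rightarrow> 'a) \<Rightarrow> bool" where
  "Cr_involution r G \<longleftrightarrow> Cr_diffeomorphism r G \<and> G \<circ> G = id"

definition Cr_reversible :: "nat \<Rightarrow> ('a::euclidean_space \<Rightarrow> 'a) \<Rightarrow> ('a \<Rightarrow> 'a) \<Rightarrow> bool" where
  "Cr_reversible r f G \<longleftrightarrow>
     Cr_diffeomorphism r f \<and> Cr_involution r G \<and> f = G \<circ> inv f \<circ> G"

end

theory Submission imports Defs begin

text \<open>
  Put \<open>s = y - \<epsilon>(y', x)\<close>. The two relations defining \<open>H(x, y) = (x', y')\<close> then become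
  \<open>x + y' = F(s)\<close>, \<open>y = s + \<epsilon>(y', x)\<close>, \<open>x' = s + \<epsilon>(x, y')\<close>,
  and this system is invariant under exchanging \<open>(x, y)\<close> with \<open>(y', x')\<close>. So whenever
  \<open>(x', y')\<close> is the image of \<open>(x, y)\<close>, the point \<open>(y, x)\<close> is a solution of the relations for an
  image of \<open>(y', x')\<close>. If it is the image, then \<open>H \<circ> h \<circ> H = h\<close>, which is reversibility.

  The symmetry alone does not exclude that the implicit relations have several solutions, of which
  \<open>H\<close> selects one. That the solution is unique follows from \<open>H\<close> being continuous and defined on the
  whole plane. For fixed \<open>x\<close>, solving the relations amounts to solving \<open>g(s) = y\<close> with
  \<open>g(s) = s + \<epsilon>(F(s) - x, x)\<close>, and \<open>H\<close> provides a solution \<open>s = \<sigma>(y)\<close> depending continuously on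
  \<open>y\<close>. A continuous right inverse \<open>\<sigma>\<close> of a continuous function of one real variable is
  onto (\<open>surj_continuous_right_inverse\<close>), hence \<open>g\<close> is injective and the solution is unique
  (\<open>implicit_solution_unique\<close>).
\<close>

lemma continuous_on_Cr_map:
  assumes "Cr_map r f"
  shows "continuous_on UNIV f"
  using assms
  by (cases r) (auto simp: continuous_on_eq_continuous_at differentiable_imp_continuous_within)

lemma Cr_map_const: "Cr_map r (\<lambda>x. c)"
  by (induction r arbitrary: c) auto

lemma Cr_map_bounded_linear:
  assumes "bounded_linear f"
  shows "Cr_map r f"
proof (cases r)
  case 0
  then show ?thesis
    using assms by (simp add: linear_continuous_on)
next
  case (Suc k)
  have deriv: "(f has_derivative f) (at x)" for x
    using assms by (rule bounded_linear_imp_has_derivative)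
  have "frechet_derivative f (at x) = f" for x
    using deriv by (metis frechet_derivative_at)
  then show ?thesis
    using deriv Suc by (auto simp: Cr_map_const differentiable_def)
qed

lemma Cr_involution_bounded_linear:
  assumes "bounded_linear G" and "G \<circ> G = id"
  shows "Cr_involution r G"
proof -
  have "inv G = G"
    using assms(2) by (metis inv_unique_comp)
  moreover have "bij G"
    using assms(2) by (metis o_bij)
  ultimately show ?thesis
    using assms by (simp add: Cr_involution_def Cr_diffeomorphism_def Cr_map_bounded_linear)
qed

text \<open>
  The range of \<open>\<sigma>\<close> is both closed, being the set of fixed points of \<open>\<sigma> \<circ> g\<close>, and open, since an
  injective continuous function on the real line is an open map.
\<close>
lemma surj_continuous_right_inverse:
  fixes g \<sigma> :: "real \<Rightarrow> real"
  assumes g: "continuous_on UNIV g" and \<sigma>: "continuous_on UNIV \<sigma>"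
    and right_inverse: "\<And>y. g (\<sigma> y) = y"
  shows "surj \<sigma>"
proof -
  have "range \<sigma> = {s. \<sigma> (g s) = s}"
    using right_inverse by (auto simp: image_iff) metis
  moreover have "closed {s. \<sigma> (g s) = s}"
    by (intro closed_Collect_eq continuous_on_compose2[OF \<sigma> g] continuous_on_id) auto
  ultimately have "closed (range \<sigma>)"
    by simp
  moreover have "inj \<sigma>"
    using right_inverse by (metis injI)
  then have "open (range \<sigma>)"
    using injective_eq_1d_open_map_UNIV[of UNIV \<sigma>] \<sigma> by (auto simp: is_interval_univ)
  ultimately show ?thesis
    using clopen[of "range \<sigma>"] by auto
qed

text \<open>
  For fixed \<open>x\<close> the relations reduce to the scalar equation \<open>g s = y\<close>, and \<open>H\<close> yields a continuous
  right inverse \<open>\<sigma>\<close> of \<open>g\<close>. Since \<open>\<sigma>\<close> is onto, every root of the equation has the form \<open>\<sigma> t\<close>, and then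
  \<open>t = g (\<sigma> t) = y\<close>.
\<close>
lemma implicit_solution_unique:
  fixes F :: "real \<Rightarrow> real" and \<epsilon> :: "real \<times> real \<Rightarrow> real"
    and H :: "real \<times> real \<Rightarrow> real \<times> real"
  assumes F: "continuous_on UNIV F" and \<epsilon>: "continuous_on UNIV \<epsilon>" and H: "continuous_on UNIV H"
    and selects: "\<And>x y x' y'. H (x, y) = (x', y') \<Longrightarrow>
           x' = y + \<epsilon> (x, y') - \<epsilon> (y', x) \<and> y' = - x + F (y - \<epsilon> (y', x))"
    and x': "x' = y + \<epsilon> (x, y') - \<epsilon> (y', x)" and y': "y' = - x + F (y - \<epsilon> (y', x))"
  shows "H (x, y) = (x', y')"
proof -
  define g where "g = (\<lambda>s. s + \<epsilon> (- x + F s, x))"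
  define \<sigma> where "\<sigma> = (\<lambda>y. y - \<epsilon> (snd (H (x, y)), x))"
  have snd_H: "snd (H (x, t)) = - x + F (\<sigma> t)" for t
    using selects[of x t "fst (H (x, t))" "snd (H (x, t))"] by (simp add: \<sigma>_def)
  have "continuous_on UNIV g"
    unfolding g_def by (intro continuous_intros F continuous_on_compose2[OF \<epsilon>]) auto
  moreover have "continuous_on UNIV \<sigma>"
    unfolding \<sigma>_def
    by (intro continuous_intros continuous_on_compose2[OF \<epsilon>] continuous_on_compose2[OF H]) auto
  moreover have g_\<sigma>: "g (\<sigma> t) = t" for t
    using snd_H[of t] by (simp add: g_def) (simp add: \<sigma>_def)
  ultimately have "surj \<sigma>"
    by (rule surj_continuous_right_inverse)
  then obtain t where t: "y - \<epsilon> (y', x) = \<sigma> t"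
    by (metis surjD)
  (* The given solution is another root of g at height y, so it is the root found by H. *)
  have "g (\<sigma> t) = y"
    using y' by (simp add: g_def flip: t)
  then have "t = y"
    using g_\<sigma> by simp
  then have "snd (H (x, y)) = y'"
    using snd_H[of y] y' t by simp
  moreover from this have "fst (H (x, y)) = x'"
    using selects[of x y "fst (H (x, y))" y'] x' by (metis prod.collapse)
  ultimately show ?thesis
    by (simp add: prod_eq_iff)
qed

theorem lemma2:
  fixes F :: "real \<Rightarrow> real"
    and \<epsilon> :: "real \<times> real \<Rightarrow> real"
    and H :: "real \<times> real \<Rightarrow> real \<times> real"
    and r :: nat
  assumes "r \<ge> 1"
    and "Cr_map r F"
    and "Cr_map r \<epsilon>"
    and "Cr_diffeomorphism r H"
    and "\<And>x y x' y'. H (x, y) = (x', y') \<Longrightarrow>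
           x' = y + \<epsilon> (x, y') - \<epsilon> (y', x) \<and> y' = - x + F (y - \<epsilon> (y', x))"
  shows "Cr_reversible r H (\<lambda>(x, y). (y, x))"
proof -
  let ?h = "\<lambda>(x, y). (y, x) :: real \<times> real"
  have "bij H" and H: "continuous_on UNIV H"
    using assms(4) by (auto simp: Cr_diffeomorphism_def intro: continuous_on_Cr_map)
  have involution: "Cr_involution r ?h"
  proof (rule Cr_involution_bounded_linear)
    show "bounded_linear ?h"
      unfolding case_prod_unfold
      by (intro bounded_linear_Pair bounded_linear_fst bounded_linear_snd)
  qed auto
  have "H p = ?h (inv H (?h p))" for p
  proof -
    obtain x y x' y' where p: "p = (x, y)" and Hp: "H (x, y) = (x', y')"
      by (metis surj_pair)
    note image = assms(5)[OF Hp]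
    (* Both right-hand sides contain the same argument of F, namely s. *)
    have s: "x' - \<epsilon> (x, y') = y - \<epsilon> (y', x)"
      using image by simp
    have "H (y', x') = (y, x)"
    proof (rule implicit_solution_unique[OF _ _ H assms(5)])
      show "continuous_on UNIV F" "continuous_on UNIV \<epsilon>"
        using assms(2,3) by (auto intro: continuous_on_Cr_map)
      show "y = x' + \<epsilon> (y', x) - \<epsilon> (x, y')"
        using s by simp
      show "x = - y' + F (x' - \<epsilon> (x, y'))"
        unfolding s using image by simp
    qed
    then have "inv H (y, x) = (y', x')"
      using \<open>bij H\<close> by (metis bij_is_inj inv_f_f)
    then show ?thesis
      using p Hp by simp
  qed
  then have "H = ?h \<circ> inv H \<circ> ?h"
    by (simp add: fun_eq_iff)
  then show ?thesis
    using assms(4) involution by (simp add: Cr_reversible_def)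
qed

end
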